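(* Let $f:\mathbb{R}^n\to\mathbb{R}$ be twice continuously differentiable and convex. Consider the problem $(\mathrm{C_4})$ of minimizing $f(x)$ over $\{x\in\mathbb{R}^n:\|x\|_1\le1\}$, and the problem $(\mathrm{NC_4})$ of minimizing $f(z_u\odot z_u-z_v\odot z_v)$ over $(z_u,z_v)\in\mathbb{R}^n\times\mathbb{R}^n$ with $\|z_u\|_2^2+\|z_v\|_2^2\le1$. Then: 1. If $x^\star$ is a second-order KKT point of $(\mathrm{C_4})$, then all $(z_u^\star,z_v^\star)$ satisfying $z_u^\star\odot z_u^\star-z_v^\star\odot z_v^\star=x^\star$ are second-order KKT points of $(\mathrm{NC_4})$. 2. Conversely, if $(z_u^\star,z_v^\star)$ is a second-order KKT point of $(\mathrm{NC_4})$, then $x^\star=z_u^\star\odot z_u^\star-z_v^\star\odot z_v^\star$ is a second-order KKT point of $(\mathrm{C_4})$.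
   Context: Notation: $[x]_k$ is the $k$th entry of $x$; $\odot$ is the entrywise product; $I_n$ is the $n\times n$ identity; $\operatorname{sign}(x)$ is the set-valued sign: $[\operatorname{sign}(x)]_k=1$ if $[x]_k>0$, $-1$ if $[x]_k<0$, and the interval $[-1,1]$ if $[x]_k=0$. Since $f$ is convex and $\|\cdot\|_1$ is nonsmooth, the KKT conditions used for $(\mathrm{C_4})$ are the first-order ones, which characterize global optimality: $x^\star$ is a (second-order) KKT point of $(\mathrm{C_4})$ if there exists $\lambda^\star\in\mathbb{R}$ with $\nabla f(x^\star)\in\lambda^\star\operatorname{sign}(x^\star)$, $\lambda^\star\le0$, $\|x^\star\|_1\le1$, $\lambda^\star(\|x^\star\|_1-1)=0$. A pair $(z_u^\star,z_v^\star)$ is a second-order KKT point of $(\mathrm{NC_4})$ if, with $\tilde x=z_u^\star\odot z_u^\star-z_v^\star\odot z_v^\star$, there exists $\lambda_N^\star\in\mathbb{R}$ with $\nabla f(\tilde x)\odot z_u^\star=\lambda_N^\star z_u^\star$, $-\nabla f(\tilde x)\odot z_v^\star=\lambda_N^\star z_v^\star$, $\|z_u^\star\|_2^2+\|z_v^\star\|_2^2\le1$, $\lambda_N^\star\le0$, $\lambda_N^\star(\|z_u^\star\|_2^2+\|z_v^\star\|_2^2-1)=0$, and the $2n\times2n$ matrix $$2\begin{bmatrix}\mathrm{diag}(\nabla f(\tilde x))-\lambda_N^\star I_n&0\\0&-\mathrm{diag}(\nabla f(\tilde x))-\lambda_N^\star I_n\end{bmatrix}+4\begin{bmatrix}\mathrm{diag}(z_u^\star)\\-\mathrm{diag}(z_v^\star)\end{bmatrix}\nabla^2f(\tilde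 x)\begin{bmatrix}\mathrm{diag}(z_u^\star)\\-\mathrm{diag}(z_v^\star)\end{bmatrix}^\top$$ is positive semidefinite.
   Formalization: Part 1 is stated only for pairs (z_u,z_v) with ‖z_u‖²+‖z_v‖² ≤ 1; for unrestricted pairs it fails, e.g. f = 0, x* = 0, z_u = z_v = (1,…,1), which is not feasible for (NC_4). *)

theory Defs
  imports "HOL-Analysis.Analysis"
begin

text \<open>
  Points of \<open>n\<close>-dimensional space are of type \<^typ>\<open>real ^ 'n\<close>; there the library's product
  \<open>x * y\<close> is the entrywise one, and \<^const>\<open>norm\<close> is the Euclidean one.
\<close>

definition gradient :: "(real ^ 'n \<Rightarrow> real) \<Rightarrow> real ^ 'n \<Rightarrow> real ^ 'n"
  where "gradient f x = (THE D. GDERIV f x :> D)"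

definition hessian :: "(real ^ 'n \<Rightarrow> real) \<Rightarrow> real ^ 'n \<Rightarrow> real ^ 'n ^ 'n"
  where "hessian f x = jacobian (gradient f) (at x)"

text \<open>Continuity of \<open>f\<close> and of its gradient is implied by their differentiability.\<close>

definition twice_continuously_differentiable :: "(real ^ 'n \<Rightarrow> real) \<Rightarrow> bool"
  where "twice_continuously_differentiable f \<longleftrightarrow>
    (\<forall>x. f differentiable (at x)) \<and>
    (\<forall>x. gradient f differentiable (at x)) \<and>
    continuous_on UNIV (hessian f)"

lemma gradient_eqI:
  assumes "GDERIV f x :> D"
  shows "gradient f x = D"
  unfolding gradient_def
proof (rule the_equality)
  fix E assume "GDERIV f x :> E"
  then have "(\<lambda>h. inner h E) = (\<lambda>h. inner h D)"
    using assms unfolding gderiv_def by (rule has_derivative_unique)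
  then have "inner h E = inner h D" for h
    by (rule fun_cong)
  then show "E = D"
    by (metis vector_eq_rdot inner_commute)
qed (rule assms)

lemma gradient_works:
  assumes "f differentiable (at x)"
  shows "GDERIV f x :> gradient f x"
proof -
  obtain f' where f': "(f has_derivative f') (at x)"
    using assms unfolding differentiable_def by blast
  interpret bounded_linear f'
    using f' by (rule has_derivative_bounded_linear)
  have "f' h = inner h (adjoint f' 1)" for h
    using adjoint_works[OF linear_axioms, of h 1] by simp
  then have "GDERIV f x :> adjoint f' 1"
    using f' unfolding gderiv_def by (metis (no_types, lifting) ext)
  then show ?thesis
    by (simp add: gradient_eqI)
qed

definition l1_norm :: "real ^ 'n \<Rightarrow> real"
  where "l1_norm x = (\<Sum>k\<in>UNIV. \<bar>x $ k\<bar>)"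

definition sign_set :: "real ^ 'n \<Rightarrow> (real ^ 'n) set"
  where "sign_set x = {s. \<forall>k.
    (x $ k > 0 \<longrightarrow> s $ k = 1) \<and>
    (x $ k < 0 \<longrightarrow> s $ k = - 1) \<and>
    (x $ k = 0 \<longrightarrow> s $ k \<in> {- 1..1})}"

definition diag :: "real ^ 'n \<Rightarrow> real ^ 'n ^ 'n"
  where "diag v = (\<chi> i j. if i = j then v $ i else 0)"

text \<open>
  The index set of size \<open>2n\<close> is the sum type \<^typ>\<open>'n + 'n\<close>: \<^const>\<open>Inl\<close> indexes the first
  \<open>n\<close> rows (columns), \<^const>\<open>Inr\<close> the last \<open>n\<close>.
\<close>

definition block_diag :: "real ^ 'n ^ 'n \<Rightarrow> real ^ 'n ^ 'n \<Rightarrow> real ^ ('n + 'n) ^ ('n + 'n)"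
  where "block_diag A B = (\<chi> i j. case (i, j) of
      (Inl k, Inl l) \<Rightarrow> A $ k $ l
    | (Inl k, Inr l) \<Rightarrow> 0
    | (Inr k, Inl l) \<Rightarrow> 0
    | (Inr k, Inr l) \<Rightarrow> B $ k $ l)"

definition block_stack :: "real ^ 'n ^ 'n \<Rightarrow> real ^ 'n ^ 'n \<Rightarrow> real ^ 'n ^ ('n + 'n)"
  where "block_stack A B = (\<chi> i. case i of Inl k \<Rightarrow> A $ k | Inr k \<Rightarrow> B $ k)"

definition positive_semidefinite :: "real ^ 'm ^ 'm \<Rightarrow> bool"
  where "positive_semidefinite A \<longleftrightarrow> transpose A = A \<and> (\<forall>v. 0 \<le> inner v (A *v v))"

definition feasible_C4 :: "(real ^ 'n) set"
  where "feasible_C4 = {x. l1_norm x \<le> 1}"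

definition feasible_NC4 :: "((real ^ 'n) \<times> (real ^ 'n)) set"
  where "feasible_NC4 = {(zu, zv). (norm zu)\<^sup>2 + (norm zv)\<^sup>2 \<le> 1}"

text \<open>
  Minimising \<open>f\<close> over \<^const>\<open>feasible_C4\<close>: since \<open>f\<close> is convex and the constraint is nonsmooth,
  the second-order KKT conditions are taken to be the first-order ones.
\<close>

definition kkt_C4 :: "(real ^ 'n \<Rightarrow> real) \<Rightarrow> real ^ 'n \<Rightarrow> bool"
  where "kkt_C4 f x \<longleftrightarrow> x \<in> feasible_C4 \<and>
    (\<exists>l::real.
      gradient f x \<in> (\<lambda>s. l *\<^sub>R s) ` sign_set x \<and>
      l \<le> 0 \<and>
      l * (l1_norm x - 1) = 0)"

text \<open>Minimising \<open>f (zu * zu - zv * zv)\<close> over \<^const>\<open>feasible_NC4\<close>.\<close>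

definition kkt2_matrix_NC4 ::
    "(real ^ 'n \<Rightarrow> real) \<Rightarrow> real ^ 'n \<Rightarrow> real ^ 'n \<Rightarrow> real \<Rightarrow> real ^ ('n + 'n) ^ ('n + 'n)"
  where "kkt2_matrix_NC4 f zu zv l =
    (let x = zu * zu - zv * zv;
         S = block_stack (diag zu) (- diag zv)
     in 2 *\<^sub>R block_diag (diag (gradient f x) - l *\<^sub>R mat 1) (- diag (gradient f x) - l *\<^sub>R mat 1)
        + 4 *\<^sub>R (S ** hessian f x ** transpose S))"

definition kkt2_NC4 :: "(real ^ 'n \<Rightarrow> real) \<Rightarrow> real ^ 'n \<Rightarrow> real ^ 'n \<Rightarrow> bool"
  where "kkt2_NC4 f zu zv \<longleftrightarrow> (zu, zv) \<in> feasible_NC4 \<and>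
    (\<exists>l::real.
      gradient f (zu * zu - zv * zv) * zu = l *\<^sub>R zu \<and>
      - gradient f (zu * zu - zv * zv) * zv = l *\<^sub>R zv \<and>
      l \<le> 0 \<and>
      l * ((norm zu)\<^sup>2 + (norm zv)\<^sup>2 - 1) = 0 \<and>
      positive_semidefinite (kkt2_matrix_NC4 f zu zv l))"

end

theory Submission
  imports Defs
begin

text \<open>
  With \<open>x = zu * zu - zv * zv\<close>, the gap \<open>(norm zu)\<^sup>2 + (norm zv)\<^sup>2 - l1_norm x\<close> is twice the sum of the
  \<open>min (zu\<^sub>k\<^sup>2) (zv\<^sub>k\<^sup>2)\<close>.  If the multiplier \<open>\<lambda>\<close> is nonzero, the supports of \<open>zu\<close> and \<open>zv\<close> are disjoint:
  for \<open>C\<^sub>4\<close> because complementarity closes the gap, for \<open>NC\<^sub>4\<close> because the two stationarity equations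
  at a common index give \<open>\<nabla>f\<^sub>k = \<lambda> = -\<nabla>f\<^sub>k\<close>.  Then \<open>zu\<close> and \<open>zv\<close> live on the positive and the negative
  part of the support of \<open>x\<close>, and there the stationarity conditions of both problems agree.  At an
  index where \<open>zu\<close> and \<open>zv\<close> both vanish, the Hessian term drops out of the diagonal of the
  second-order matrix, whose nonnegativity is exactly \<open>\<bar>\<nabla>f\<^sub>k\<bar> \<le> -\<lambda>\<close>.  Conversely this bound makes the
  first summand of the matrix positive semidefinite, and the second one is a congruence of the
  Hessian of a convex function.
\<close>

section \<open>The Hessian of a twice continuously differentiable function\<close>

lemma has_real_derivative_along_line:
  fixes f :: "real ^ 'n \<Rightarrow> real"
  assumes "f differentiable (at (a + t *\<^sub>R u))"
  shows "((\<lambda>s. f (a + s *\<^sub>R u)) has_real_derivative u \<bullet> gradient f (a + t *\<^sub>R u)) (at t)"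
proof -
  have "(f has_derivative (\<lambda>h. h \<bullet> gradient f (a + t *\<^sub>R u))) (at (a + t *\<^sub>R u))"
    using gradient_works[OF assms] by (simp add: gderiv_def)
  moreover have "((\<lambda>s. a + s *\<^sub>R u) has_derivative (\<lambda>s. s *\<^sub>R u)) (at t)"
    by (auto intro!: derivative_eq_intros)
  ultimately have "((\<lambda>s. f (a + s *\<^sub>R u)) has_derivative
      (\<lambda>s. (s *\<^sub>R u) \<bullet> gradient f (a + t *\<^sub>R u))) (at t)"
    by (rule has_derivative_compose[rotated])
  then show ?thesis
    by (simp add: has_field_derivative_def mult_commute_abs)
qed

lemma gradient_has_real_derivative_along_line:
  fixes f :: "real ^ 'n \<Rightarrow> real"
  assumes "gradient f differentiable (at (a + t *\<^sub>R v))"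
  shows "((\<lambda>s. u \<bullet> gradient f (a + s *\<^sub>R v)) has_real_derivative
    u \<bullet> (hessian f (a + t *\<^sub>R v) *v v)) (at t)"
proof -
  have "(gradient f has_derivative (\<lambda>h. hessian f (a + t *\<^sub>R v) *v h)) (at (a + t *\<^sub>R v))"
    using assms by (simp add: hessian_def jacobian_works)
  moreover have "((\<lambda>s. a + s *\<^sub>R v) has_derivative (\<lambda>s. s *\<^sub>R v)) (at t)"
    by (auto intro!: derivative_eq_intros)
  ultimately have "((\<lambda>s. gradient f (a + s *\<^sub>R v)) has_derivative
      (\<lambda>s. hessian f (a + t *\<^sub>R v) *v (s *\<^sub>R v))) (at t)"
    by (rule has_derivative_compose[rotated])
  then have "((\<lambda>s. u \<bullet> gradient f (a + s *\<^sub>R v)) has_derivative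
      (\<lambda>s. u \<bullet> (hessian f (a + t *\<^sub>R v) *v (s *\<^sub>R v)))) (at t)"
    by (rule has_derivative_inner_right)
  then show ?thesis
    by (simp add: has_field_derivative_def matrix_vector_mult_scaleR mult_commute_abs)
qed

text \<open>The second difference is symmetric in \<open>u\<close> and \<open>v\<close>; this is what makes the Hessian symmetric.\<close>

lemma second_difference_mean_value:
  fixes f :: "real ^ 'n \<Rightarrow> real"
  assumes f: "\<And>x. f differentiable (at x)"
    and g: "\<And>x. gradient f differentiable (at x)"
    and t: "0 < t"
  obtains a b where "0 < a" "a < t" "0 < b" "b < t"
    "f (x + t *\<^sub>R u + t *\<^sub>R v) - f (x + t *\<^sub>R u) - f (x + t *\<^sub>R v) + f x =
      t\<^sup>2 * (u \<bullet> (hessian f (x + a *\<^sub>R u + b *\<^sub>R v) *v v))"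
proof -
  \<comment> \<open>The increment of \<open>f\<close> in direction \<open>v\<close>, as a function
    of the step in direction \<open>u\<close>. Its derivative is itself an increment of
    \<open>u \<bullet> gradient f\<close> in direction \<open>v\<close>, so the mean value theorem
    applies a second time, to \<open>q\<close>.\<close>
  define p where "p s = f ((x + t *\<^sub>R v) + s *\<^sub>R u) - f (x + s *\<^sub>R u)" for s
  have "DERIV p s :> u \<bullet> gradient f ((x + t *\<^sub>R v) + s *\<^sub>R u) - u \<bullet> gradient f (x + s *\<^sub>R u)" for s
    unfolding p_def by (intro DERIV_diff has_real_derivative_along_line f)
  then obtain a where a: "0 < a" "a < t" "p t - p 0 =
      (t - 0) * (u \<bullet> gradient f ((x + t *\<^sub>R v) + a *\<^sub>R u) - u \<bullet> gradient f (x + a *\<^sub>R u))"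
    using MVT2[OF t, of p "\<lambda>s. u \<bullet> gradient f ((x + t *\<^sub>R v) + s *\<^sub>R u) - u \<bullet> gradient f (x + s *\<^sub>R u)"]
    by blast
  define q where "q s = u \<bullet> gradient f ((x + a *\<^sub>R u) + s *\<^sub>R v)" for s
  have "DERIV q s :> u \<bullet> (hessian f ((x + a *\<^sub>R u) + s *\<^sub>R v) *v v)" for s
    unfolding q_def by (intro gradient_has_real_derivative_along_line g)
  then obtain b where b: "0 < b" "b < t"
      "q t - q 0 = (t - 0) * (u \<bullet> (hessian f ((x + a *\<^sub>R u) + b *\<^sub>R v) *v v))"
    using MVT2[OF t, of q "\<lambda>s. u \<bullet> (hessian f ((x + a *\<^sub>R u) + s *\<^sub>R v) *v v)"]
    by blast
  have "p t - p 0 = t * (q t - q 0)"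
    using a(3) by (simp add: q_def add_ac)
  then have "p t - p 0 = t\<^sup>2 * (u \<bullet> (hessian f (x + a *\<^sub>R u + b *\<^sub>R v) *v v))"
    using b(3) by (simp add: power2_eq_square)
  moreover have "p t - p 0 =
      f (x + t *\<^sub>R u + t *\<^sub>R v) - f (x + t *\<^sub>R u) - f (x + t *\<^sub>R v) + f x"
    by (simp add: p_def add_ac)
  ultimately show ?thesis
    using that a b by metis
qed

text \<open>The mean value points lie within one step of \<open>x\<close> in both directions, so
  they converge to \<open>x\<close>, and continuity of the Hessian identifies the limit. One null
  sequence of steps is enough, since only uniqueness of limits is needed afterwards.\<close>

lemma second_difference_quotient_tendsto:
  fixes f :: "real ^ 'n \<Rightarrow> real"
  assumes f: "twice_continuously_differentiable f"
  shows "(\<lambda>n. (f (x + inverse (real (Suc n)) *\<^sub>R u + inverse (real (Suc n)) *\<^sub>R v)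
      - f (x + inverse (real (Suc n)) *\<^sub>R u) - f (x + inverse (real (Suc n)) *\<^sub>R v) + f x)
      / (inverse (real (Suc n)))\<^sup>2)
    \<longlonglongrightarrow> u \<bullet> (hessian f x *v v)"
proof -
  define t where "t n = inverse (real (Suc n))" for n
  define q where "q n = (f (x + t n *\<^sub>R u + t n *\<^sub>R v) - f (x + t n *\<^sub>R u) - f (x + t n *\<^sub>R v) + f x)
    / (t n)\<^sup>2" for n
  have t0: "t \<longlonglongrightarrow> 0"
    unfolding t_def using LIMSEQ_inverse_real_of_nat .
  have "\<exists>a b. 0 < a \<and> a < t n \<and> 0 < b \<and> b < t n \<and>
      q n = u \<bullet> (hessian f (x + a *\<^sub>R u + b *\<^sub>R v) *v v)" for n
  proof -
    have t: "0 < t n"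
      by (simp add: t_def)
    obtain a b where "0 < a" "a < t n" "0 < b" "b < t n"
      "f (x + t n *\<^sub>R u + t n *\<^sub>R v) - f (x + t n *\<^sub>R u) - f (x + t n *\<^sub>R v) + f x =
        (t n)\<^sup>2 * (u \<bullet> (hessian f (x + a *\<^sub>R u + b *\<^sub>R v) *v v))"
      using second_difference_mean_value[of f "t n" x u v] f t
      unfolding twice_continuously_differentiable_def by blast
    then show ?thesis
      using t unfolding q_def by (intro exI[of _ a] exI[of _ b]) simp
  qed
  then obtain a b where ab: "\<And>n. 0 < a n" "\<And>n. a n < t n" "\<And>n. 0 < b n" "\<And>n. b n < t n"
      "\<And>n. q n = u \<bullet> (hessian f (x + a n *\<^sub>R u + b n *\<^sub>R v) *v v)"
    by metis
  have "a \<longlonglongrightarrow> 0" "b \<longlonglongrightarrow> 0"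
    \<comment> \<open>Squeezed between 0 and \<open>t n\<close>.\<close>
    using ab by (auto intro!: tendsto_sandwich[OF _ _ tendsto_const t0] always_eventually
        simp: less_imp_le)
  then have "(\<lambda>n. x + a n *\<^sub>R u + b n *\<^sub>R v) \<longlonglongrightarrow> x + 0 *\<^sub>R u + 0 *\<^sub>R v"
    by (intro tendsto_intros)
  moreover have "isCont (hessian f) x"
    using f by (simp add: twice_continuously_differentiable_def continuous_on_eq_continuous_at)
  ultimately have H: "(\<lambda>n. hessian f (x + a n *\<^sub>R u + b n *\<^sub>R v)) \<longlonglongrightarrow> hessian f x"
    by (auto intro: isCont_tendsto_compose)
  have "(\<lambda>n. u \<bullet> (hessian f (x + a n *\<^sub>R u + b n *\<^sub>R v) *v v)) \<longlonglongrightarrow> u \<bullet> (hessian f x *v v)"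
    unfolding matrix_vector_mult_def by (intro tendsto_intros H)
  then have "q \<longlonglongrightarrow> u \<bullet> (hessian f x *v v)"
    using ab(5) by presburger
  then show ?thesis
    by (simp add: q_def[abs_def] t_def)
qed

text \<open>Schwarz's theorem: exchanging \<open>u\<close> and \<open>v\<close> leaves the second
  difference quotient unchanged, so the two limits agree; basis vectors then give the
  entries.\<close>

lemma hessian_transpose:
  fixes f :: "real ^ 'n \<Rightarrow> real"
  assumes "twice_continuously_differentiable f"
  shows "transpose (hessian f x) = hessian f x"
proof -
  have "u \<bullet> (hessian f x *v v) = v \<bullet> (hessian f x *v u)" for u v
    using second_difference_quotient_tendsto[OF assms, of x v u]
    by (intro LIMSEQ_unique[OF second_difference_quotient_tendsto[OF assms]])
      (simp add: algebra_simps)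
  then have "axis i 1 \<bullet> (hessian f x *v axis j 1) = axis j 1 \<bullet> (hessian f x *v axis i 1)" for i j
    by blast
  then have "hessian f x $ i $ j = hessian f x $ j $ i" for i j
    by (simp add: inner_axis' matrix_vector_mul_component inner_axis)
  then show ?thesis
    by (simp add: vec_eq_iff transpose_def)
qed

text \<open>The restriction of \<open>f\<close> to a line is convex and lies above its tangents,
  which makes its derivative monotone.\<close>

lemma convex_gradient_mono_along_line:
  fixes f :: "real ^ 'n \<Rightarrow> real"
  assumes f: "\<And>x. f differentiable (at x)" and convex: "convex_on UNIV f"
  shows "mono (\<lambda>t. h \<bullet> gradient f (x + t *\<^sub>R h))"
proof (rule monoI)
  fix s t :: real
  assume "s \<le> t"
  define p where "p t = f (x + t *\<^sub>R h)" for t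
  let ?p' = "\<lambda>t. h \<bullet> gradient f (x + t *\<^sub>R h)"
  have "convex_on UNIV p"
  proof (rule convex_onI)
    fix c a b :: real
    assume "0 < c" "c < 1"
    then have "f ((1 - c) *\<^sub>R (x + a *\<^sub>R h) + c *\<^sub>R (x + b *\<^sub>R h)) \<le>
        (1 - c) * f (x + a *\<^sub>R h) + c * f (x + b *\<^sub>R h)"
      using convex by (intro convex_onD) auto
    moreover have "(1 - c) *\<^sub>R (x + a *\<^sub>R h) + c *\<^sub>R (x + b *\<^sub>R h) =
        x + ((1 - c) *\<^sub>R a + c *\<^sub>R b) *\<^sub>R h"
      by (simp add: algebra_simps)
    ultimately show "p ((1 - c) *\<^sub>R a + c *\<^sub>R b) \<le> (1 - c) * p a + c * p b"
      by (simp add: p_def)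
  qed simp
  moreover have "DERIV p t :> ?p' t" for t
    unfolding p_def by (rule has_real_derivative_along_line[OF f])
  ultimately have tangent: "p b - p a \<ge> ?p' a * (b - a)" for a b
    by (intro convex_on_imp_above_tangent[of UNIV]) auto
  \<comment> \<open>Adding the tangent inequalities at \<open>s\<close> and at \<open>t\<close>
    cancels the values of \<open>p\<close>.\<close>
  have "0 \<le> (?p' t - ?p' s) * (t - s)"
    using tangent[of s t] tangent[of t s] by (simp add: algebra_simps)
  then show "?p' s \<le> ?p' t"
    using \<open>s \<le> t\<close> by (cases "s = t") (auto simp: zero_le_mult_iff)
qed

text \<open>The quadratic form at \<open>h\<close> is the derivative at 0 of the slope of
  \<open>f\<close> along \<open>h\<close>, a monotone function.\<close>

lemma positive_semidefinite_hessian: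
  fixes f :: "real ^ 'n \<Rightarrow> real"
  assumes f: "twice_continuously_differentiable f" and convex: "convex_on UNIV f"
  shows "positive_semidefinite (hessian f x)"
proof -
  have "0 \<le> h \<bullet> (hessian f x *v h)" for h
  proof (rule mono_on_imp_deriv_nonneg[where A = UNIV and x = 0])
    show "mono_on UNIV (\<lambda>t. h \<bullet> gradient f (x + t *\<^sub>R h))"
      using f convex
      by (intro convex_gradient_mono_along_line)
        (auto simp: twice_continuously_differentiable_def)
    show "((\<lambda>t. h \<bullet> gradient f (x + t *\<^sub>R h)) has_real_derivative h \<bullet> (hessian f x *v h)) (at 0)"
      using gradient_has_real_derivative_along_line[of f x 0 h h] f
      by (simp add: twice_continuously_differentiable_def)
  qed simp
  then show ?thesis
    using hessian_transpose[OF f] by (simp add: positive_semidefinite_def)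
qed

section \<open>Positive semidefinite matrices\<close>

lemma positive_semidefinite_add:
  assumes "positive_semidefinite A" "positive_semidefinite B"
  shows "positive_semidefinite (A + B)"
  using assms
  by (auto simp: positive_semidefinite_def transpose_def vec_eq_iff
      matrix_vector_mult_add_rdistrib inner_add_right)

lemma positive_semidefinite_scaleR:
  assumes "positive_semidefinite A" "0 \<le> c"
  shows "positive_semidefinite (c *\<^sub>R A)"
  using assms
  by (auto simp: positive_semidefinite_def transpose_def vec_eq_iff
      scaleR_matrix_vector_assoc[symmetric])

lemma positive_semidefinite_congruence:
  fixes A :: "real ^ 'm ^ 'm" and S :: "real ^ 'm ^ 'k"
  assumes "positive_semidefinite A"
  shows "positive_semidefinite (S ** A ** transpose S)"
proof -
  have "v \<bullet> ((S ** A ** transpose S) *v v) = (transpose S *v v) \<bullet> (A *v (transpose S *v v))" for v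
    by (simp add: matrix_vector_mul_assoc[symmetric] dot_lmul_matrix[symmetric])
  then show ?thesis
    using assms by (simp add: positive_semidefinite_def matrix_transpose_mul matrix_mul_assoc)
qed

lemma positive_semidefinite_diag:
  assumes "\<And>i. 0 \<le> d $ i"
  shows "positive_semidefinite (diag d)"
proof -
  have "diag d *v v = d * v" for v
    by (simp add: vec_eq_iff diag_def matrix_vector_mult_def if_distribR
        if_distrib[of "\<lambda>x. x * _"] sum.delta' cong: if_cong)
  then have "v \<bullet> (diag d *v v) = (\<Sum>i\<in>UNIV. d $ i * (v $ i)\<^sup>2)" for v
    by (simp add: inner_vec_def power2_eq_square mult_ac)
  then show ?thesis
    using assms by (auto simp: positive_semidefinite_def transpose_def diag_def vec_eq_iff
        intro!: sum_nonneg)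
qed

lemma positive_semidefinite_diagonal_nonneg:
  assumes "positive_semidefinite A"
  shows "0 \<le> A $ i $ i"
proof -
  have "0 \<le> axis i 1 \<bullet> (A *v axis i 1)"
    using assms by (simp add: positive_semidefinite_def)
  then show ?thesis
    by (simp add: inner_axis' matrix_vector_mul_component inner_axis)
qed

text \<open>The matrix is diagonal, with entries \<open>g $ k - l\<close> and
  \<open>- g $ k - l\<close>; the bound says that both are nonnegative.\<close>

lemma positive_semidefinite_block_diag:
  fixes g :: "real ^ 'n"
  assumes "\<And>k. \<bar>g $ k\<bar> \<le> - l"
  shows "positive_semidefinite (block_diag (diag g - l *\<^sub>R mat 1) (- diag g - l *\<^sub>R mat 1))"
proof -
  define d :: "real ^ ('n + 'n)"
    where "d = (\<chi> i. case i of Inl k \<Rightarrow> g $ k - l | Inr k \<Rightarrow> - g $ k - l)"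
  have "block_diag (diag g - l *\<^sub>R mat 1) (- diag g - l *\<^sub>R mat 1) = diag d"
    by (auto simp: vec_eq_iff block_diag_def diag_def d_def mat_def split: sum.split)
  moreover have "0 \<le> d $ i" for i
  proof (cases i)
    case (Inl k)
    then show ?thesis
      using assms[of k] by (simp add: d_def)
  next
    case (Inr k)
    then show ?thesis
      using assms[of k] by (simp add: d_def)
  qed
  ultimately show ?thesis
    by (simp add: positive_semidefinite_diag)
qed

text \<open>The entry is the quadratic form of \<open>A\<close> evaluated at row \<open>i\<close> of
  \<open>S\<close>. This removes the Hessian from the second-order matrix at indices where
  \<open>zu\<close> or \<open>zv\<close> vanishes.\<close>

lemma congruence_diagonal_eq_0:
  fixes A :: "real ^ 'm ^ 'm" and S :: "real ^ 'm ^ 'k"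
  assumes "S $ i = 0"
  shows "(S ** A ** transpose S) $ i $ i = 0"
  using assms by (simp add: matrix_matrix_mult_def transpose_def)

lemma kkt2_matrix_NC4_diagonal_Inl:
  assumes "zu $ k = 0"
  shows "kkt2_matrix_NC4 f zu zv l $ Inl k $ Inl k = 2 * (gradient f (zu * zu - zv * zv) $ k - l)"
proof -
  have "block_stack (diag zu) (- diag zv) $ Inl k = 0"
    using assms by (simp add: block_stack_def diag_def vec_eq_iff)
  then show ?thesis
    by (simp add: kkt2_matrix_NC4_def Let_def congruence_diagonal_eq_0)
      (simp add: block_diag_def diag_def mat_def)
qed

lemma kkt2_matrix_NC4_diagonal_Inr:
  assumes "zv $ k = 0"
  shows "kkt2_matrix_NC4 f zu zv l $ Inr k $ Inr k = 2 * (- gradient f (zu * zu - zv * zv) $ k - l)"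
proof -
  have "block_stack (diag zu) (- diag zv) $ Inr k = 0"
    using assms by (simp add: block_stack_def diag_def vec_eq_iff)
  then show ?thesis
    by (simp add: kkt2_matrix_NC4_def Let_def congruence_diagonal_eq_0)
      (simp add: block_diag_def diag_def mat_def)
qed

section \<open>Correspondence of the KKT points\<close>

text \<open>Entrywise this is a + b - |a - b| = 2 min(a, b), with a and b the squares of the
  entries.\<close>

lemma norm_squares_minus_l1_norm:
  fixes zu zv :: "real ^ 'n"
  shows "(norm zu)\<^sup>2 + (norm zv)\<^sup>2 - l1_norm (zu * zu - zv * zv) =
    2 * (\<Sum>k\<in>UNIV. min ((zu $ k)\<^sup>2) ((zv $ k)\<^sup>2))"
proof -
  have "(norm z)\<^sup>2 = (\<Sum>k\<in>UNIV. (z $ k)\<^sup>2)" for z :: "real ^ 'n"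
    by (simp add: power2_norm_eq_inner inner_vec_def power2_eq_square[of "_ $ _"])
  then show ?thesis
    by (simp add: l1_norm_def sum.distrib[symmetric] sum_subtractf[symmetric] sum_distrib_left
        power2_eq_square[of "_ $ _", symmetric])
      (auto intro!: sum.cong simp: min_def)
qed

lemma l1_norm_le_norm_squares:
  "l1_norm (zu * zu - zv * zv) \<le> (norm zu)\<^sup>2 + (norm zv)\<^sup>2"
proof -
  have "0 \<le> (\<Sum>k\<in>UNIV. min ((zu $ k)\<^sup>2) ((zv $ k)\<^sup>2))"
    by (intro sum_nonneg) simp
  then show ?thesis
    using norm_squares_minus_l1_norm[of zu zv] by linarith
qed

lemma l1_norm_eq_norm_squares_iff:
  "l1_norm (zu * zu - zv * zv) = (norm zu)\<^sup>2 + (norm zv)\<^sup>2 \<longleftrightarrow> (\<forall>k. zu $ k = 0 \<or> zv $ k = 0)"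
proof -
  have "l1_norm (zu * zu - zv * zv) = (norm zu)\<^sup>2 + (norm zv)\<^sup>2 \<longleftrightarrow>
      (\<Sum>k\<in>UNIV. min ((zu $ k)\<^sup>2) ((zv $ k)\<^sup>2)) = 0"
    using norm_squares_minus_l1_norm[of zu zv] by linarith
  also have "\<dots> \<longleftrightarrow> (\<forall>k. min ((zu $ k)\<^sup>2) ((zv $ k)\<^sup>2) = 0)"
    by (subst sum_nonneg_eq_0_iff) auto
  also have "\<dots> \<longleftrightarrow> (\<forall>k. zu $ k = 0 \<or> zv $ k = 0)"
    by (auto simp: min_def) (metis power_zero_numeral zero_le_power2)
  finally show ?thesis .
qed

text \<open>Eliminates the subgradient \<open>s\<close>, so that both problems can be compared
  through \<open>g\<close> and \<open>l\<close> alone. The bound may be asked at every index: where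
  \<open>x $ k\<close> is nonzero it follows from the equations, as
  \<open>l \<le> 0\<close>.\<close>

lemma mem_scaleR_sign_set_iff:
  fixes g x :: "real ^ 'n"
  assumes "l \<le> 0"
  shows "g \<in> (\<lambda>s. l *\<^sub>R s) ` sign_set x \<longleftrightarrow>
    (\<forall>k. (0 < x $ k \<longrightarrow> g $ k = l) \<and> (x $ k < 0 \<longrightarrow> g $ k = - l) \<and> \<bar>g $ k\<bar> \<le> - l)"
    (is "_ \<longleftrightarrow> (\<forall>k. ?P k)")
proof
  assume "g \<in> (\<lambda>s. l *\<^sub>R s) ` sign_set x"
  then obtain s where s: "s \<in> sign_set x" "g = l *\<^sub>R s"
    by blast
  show "\<forall>k. ?P k"
  proof
    fix k
    have sk: "(0 < x $ k \<longrightarrow> s $ k = 1) \<and> (x $ k < 0 \<longrightarrow> s $ k = -1) \<and> \<bar>s $ k\<bar> \<le> 1"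
      using s(1) by (cases "x $ k" "0 :: real" rule: linorder_cases)
        (auto simp: sign_set_def abs_le_iff)
    then have "\<bar>g $ k\<bar> \<le> - l"
      using s(2) assms mult_left_mono[of "\<bar>s $ k\<bar>" 1 "- l"] by (simp add: abs_mult)
    then show "?P k"
      using sk s(2) by simp
  qed
next
  assume P: "\<forall>k. ?P k"
  show "g \<in> (\<lambda>s. l *\<^sub>R s) ` sign_set x"
  proof (cases "l = 0")
    case True
    \<comment> \<open>Here division by \<open>l\<close> is impossible, but the bound forces
      \<open>g = 0\<close>, so any member of \<open>sign_set x\<close> is a witness.\<close>
    then have "g = l *\<^sub>R (\<chi> k. sgn (x $ k))"
      using P by (simp add: vec_eq_iff)
    moreover have "(\<chi> k. sgn (x $ k)) \<in> sign_set x"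
      by (simp add: sign_set_def)
    ultimately show ?thesis
      by blast
  next
    case False
    then have l: "l < 0"
      using assms by simp
    have "(1 / l) *\<^sub>R g \<in> sign_set x"
      unfolding sign_set_def
    proof (intro CollectI allI conjI impI)
      fix k
      show "((1 / l) *\<^sub>R g) $ k = 1" if "0 < x $ k"
        using that P l by simp
      show "((1 / l) *\<^sub>R g) $ k = - 1" if "x $ k < 0"
        using that P l by simp
      show "((1 / l) *\<^sub>R g) $ k \<in> {- 1..1}" if "x $ k = 0"
      proof -
        have "\<bar>g $ k\<bar> \<le> - l"
          using P by blast
        then show ?thesis
          using l by (auto simp: field_simps abs_le_iff)
      qed
    qed
    moreover have "g = l *\<^sub>R ((1 / l) *\<^sub>R g)"
      using l by simp
    ultimately show ?thesis
      by blast
  qed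
qed

text \<open>The multiplier is carried over unchanged. Feasibility of the pair is assumed because it
  does not follow from that of \<open>x\<close>: adding the same amount to both squares leaves
  \<open>x\<close> fixed but increases the norms.\<close>

lemma kkt_C4_imp_kkt2_NC4:
  fixes f :: "real ^ 'n \<Rightarrow> real"
  assumes f: "twice_continuously_differentiable f" and convex: "convex_on UNIV f"
    and kkt: "kkt_C4 f (zu * zu - zv * zv)" and feasible: "(zu, zv) \<in> feasible_NC4"
  shows "kkt2_NC4 f zu zv"
proof -
  define x where "x = zu * zu - zv * zv"
  define g where "g = gradient f x"
  obtain l where l: "l \<le> 0" "g \<in> (\<lambda>s. l *\<^sub>R s) ` sign_set x" "l * (l1_norm x - 1) = 0"
    using kkt by (auto simp: kkt_C4_def x_def g_def)
  have g: "0 < x $ k \<Longrightarrow> g $ k = l" "x $ k < 0 \<Longrightarrow> g $ k = - l" "\<bar>g $ k\<bar> \<le> - l" for k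
    using l mem_scaleR_sign_set_iff by blast+
  have norms: "(norm zu)\<^sup>2 + (norm zv)\<^sup>2 = 1" and disjoint: "zu $ k = 0 \<or> zv $ k = 0"
    if "l \<noteq> 0" for k
  proof -
    have "l1_norm x = 1"
      using l(3) that by simp
    \<comment> \<open>The sum of squares lies between \<open>l1_norm x\<close>, which is 1, and the
      feasibility bound 1.\<close>
    then show "(norm zu)\<^sup>2 + (norm zv)\<^sup>2 = 1"
      using feasible l1_norm_le_norm_squares[of zu zv] by (simp add: feasible_NC4_def x_def)
    with \<open>l1_norm x = 1\<close> show "zu $ k = 0 \<or> zv $ k = 0"
      using l1_norm_eq_norm_squares_iff[of zu zv] by (simp add: x_def)
  qed
  have x: "x $ k = (zu $ k)\<^sup>2 - (zv $ k)\<^sup>2" for k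
    by (simp add: x_def power2_eq_square)
  have u: "g $ k * zu $ k = l * zu $ k" for k
  \<comment> \<open>For \<open>l = 0\<close> the bound gives \<open>g $ k = 0\<close>. Otherwise a
    nonzero \<open>zu $ k\<close> forces \<open>zv $ k = 0\<close>, hence a positive
    \<open>x $ k\<close>.\<close>
  proof (cases "l = 0 \<or> zu $ k = 0")
    case True
    then show ?thesis
      using g(3)[of k] by auto
  next
    case False
    then have "0 < x $ k"
      using disjoint[of k] by (simp add: x)
    then show ?thesis
      using g(1) by simp
  qed
  have v: "- g $ k * zv $ k = l * zv $ k" for k
  proof (cases "l = 0 \<or> zv $ k = 0")
    case True
    then show ?thesis
      using g(3)[of k] by auto
  next
    case False
    then have "x $ k < 0"
      using disjoint[of k] by (simp add: x)
    then show ?thesis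
      using g(2) by simp
  qed
  have "positive_semidefinite (kkt2_matrix_NC4 f zu zv l)"
    unfolding kkt2_matrix_NC4_def Let_def x_def[symmetric] g_def[symmetric]
    using g(3)
    by (intro positive_semidefinite_add positive_semidefinite_scaleR
        positive_semidefinite_block_diag positive_semidefinite_congruence
        positive_semidefinite_hessian[OF f convex]) auto
  then show ?thesis
    using feasible l(1) u v norms
    unfolding kkt2_NC4_def x_def[symmetric] g_def[symmetric]
    by (auto simp: vec_eq_iff intro!: exI[of _ l])
qed

lemma kkt2_NC4_imp_kkt_C4:
  fixes f :: "real ^ 'n \<Rightarrow> real"
  assumes kkt: "kkt2_NC4 f zu zv"
  shows "kkt_C4 f (zu * zu - zv * zv)"
proof -
  define x where "x = zu * zu - zv * zv"
  define g where "g = gradient f x"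
  obtain l where l: "l \<le> 0" "g * zu = l *\<^sub>R zu" "- g * zv = l *\<^sub>R zv"
      "l * ((norm zu)\<^sup>2 + (norm zv)\<^sup>2 - 1) = 0"
      and psd: "positive_semidefinite (kkt2_matrix_NC4 f zu zv l)"
    using kkt by (auto simp: kkt2_NC4_def x_def g_def)
  have feasible: "(norm zu)\<^sup>2 + (norm zv)\<^sup>2 \<le> 1"
    using kkt by (simp add: kkt2_NC4_def feasible_NC4_def)
  have u: "g $ k = l" if "zu $ k \<noteq> 0" for k
    using arg_cong[OF l(2), of "\<lambda>z. z $ k"] that by simp
  have v: "g $ k = - l" if "zv $ k \<noteq> 0" for k
  proof -
    have "(- g $ k) * zv $ k = l * zv $ k"
      using arg_cong[OF l(3), of "\<lambda>z. z $ k"] by simp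
    then have "- g $ k = l"
      using that mult_right_cancel by blast
    then show ?thesis
      by simp
  qed
  have x: "x $ k = (zu $ k)\<^sup>2 - (zv $ k)\<^sup>2" for k
    by (simp add: x_def power2_eq_square)
  have "\<bar>g $ k\<bar> \<le> - l" for k
  \<comment> \<open>Second-order information is needed only where both entries vanish; elsewhere
    stationarity already gives \<open>g $ k\<close> as \<open>l\<close> or
    \<open>- l\<close>.\<close>
  proof (cases "zu $ k = 0 \<and> zv $ k = 0")
    case True
    then show ?thesis
      using positive_semidefinite_diagonal_nonneg[OF psd, of "Inl k"]
        positive_semidefinite_diagonal_nonneg[OF psd, of "Inr k"]
      by (simp add: kkt2_matrix_NC4_diagonal_Inl kkt2_matrix_NC4_diagonal_Inr x_def g_def)
  next
    case False
    then show ?thesis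
      using u[of k] v[of k] l(1) by auto
  qed
  moreover have "g $ k = l" if "0 < x $ k" for k
    using that by (intro u) (auto simp: x)
  moreover have "g $ k = - l" if "x $ k < 0" for k
    using that by (intro v) (auto simp: x)
  ultimately have "g \<in> (\<lambda>s. l *\<^sub>R s) ` sign_set x"
    using mem_scaleR_sign_set_iff[OF l(1)] by blast
  moreover have "l * (l1_norm x - 1) = 0"
  proof (cases "l = 0")
    case False
    \<comment> \<open>At a common support index, \<open>u\<close> and \<open>v\<close> would give
      \<open>l = - l\<close>.\<close>
    then have "\<forall>k. zu $ k = 0 \<or> zv $ k = 0"
      using u v by force
    then have "l1_norm x = (norm zu)\<^sup>2 + (norm zv)\<^sup>2"
      by (simp add: x_def l1_norm_eq_norm_squares_iff)
    then show ?thesis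
      using l(4) by simp
  qed simp
  moreover have "l1_norm x \<le> 1"
    using feasible l1_norm_le_norm_squares[of zu zv] by (simp add: x_def)
  ultimately show ?thesis
    using l(1) by (auto simp: kkt_C4_def feasible_C4_def x_def g_def)
qed

theorem theorem9:
  fixes f :: "real ^ 'n \<Rightarrow> real"
  assumes "twice_continuously_differentiable f"
    and "convex_on UNIV f"
  shows "(\<forall>x. kkt_C4 f x \<longrightarrow>
            (\<forall>(zu, zv)\<in>feasible_NC4. zu * zu - zv * zv = x \<longrightarrow> kkt2_NC4 f zu zv)) \<and>
         (\<forall>zu zv. kkt2_NC4 f zu zv \<longrightarrow> kkt_C4 f (zu * zu - zv * zv))"
  using kkt_C4_imp_kkt2_NC4[OF assms] kkt2_NC4_imp_kkt_C4 by blast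

end
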